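(* Let $\theta>0$, $r>0$ and let the blocklength $l$ be a positive integer. Define the effective capacity of truncated HARQ-enabled D2D ($M=2$) under queue model $n_2$ as $EC^{\mathrm{HARQ}}_{n_2}=-\frac1\theta\log_e\rho(\mathbf B_{n_2})$, where $\rho$ denotes the spectral radius and $\mathbf B_{n_2}=\begin{bmatrix} b_{1,n_2}&b_{2,n_2}\\1&0\end{bmatrix}$ with $b_{1,n_2},b_{2,n_2}$ as given in the context. Then $$EC^{\mathrm{HARQ}}_{n_2}=-\frac1\theta\log_e\Big\{\tfrac12\Big(\big(e^{-lr\theta}\varphi+p^{\mathrm{off}}_u\big)+\sqrt{\big(e^{-lr\theta}\varphi+p^{\mathrm{off}}_u\big)^2+4\big(e^{-lr\theta}\varrho+p^{\mathrm{off}}_o\big)}\Big)\Big\},$$ where $\varphi=p_{u,1}\alpha_d+p_{u,3}\alpha_{mC}+p_{u,5}\alpha_{MC}$, $\varrho=p_{o,1}\mathbb E_z[\zeta^{d}_{o,1}]+p_{o,3}\mathbb E_z[\zeta^{mC}_{o,1}]+p_{o,5}\mathbb E_z[\zeta^{MC}_{o,1}]$, $p^{\mathrm{off}}_u=p_{u,2}+p_{u,4}+p_{u,6}$, $p^{\mathrm{off}}_o=p_{o,2}+p_{o,4}+p_{o,6}$.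
   Context: Setting: a device $D_T$ sends packets to $D_R$ at fixed rate $r$ through one of three modes: direct ($d$), via a micro-cell base station ($mC$), via a macro-cell base station ($MC$). At most $M=2$ attempts are made per packet, the first in underlay settings (subscript $u$), the second in overlay settings (subscript $o$). In queue model $n_2$, a packet not decoded after $M$ attempts is deleted from the queue. $\theta$ is the QoS exponent, $l$ the length of a fading block. State probabilities. In each slot the link is in one of six states: states 1, 3, 5 mean that mode $d$, $mC$, $MC$ respectively is selected and the link is ON (its SNR, or in underlay its signal-to-interference ratio, exceeds $\gamma_{req}=2^{r/B}-1$, with $B>0$ the bandwidth), and states 2, 4, 6 mean that the respective mode is selected and the link is OFF. Mode selection and fading are independent of each other and over time, so the transition matrices have identical rows $\mathbf p_{o}=[p_{o,1},\dots,p_{o,6}]$ (overlay) and $\mathbf p_{u}=[p_{u,1},\dots,p_{u,6}]$ (underlay), which are probability vectors; each entry is the product of the probability of selecting the mode and the probability of the link being ON/OFF. Decoding error probabilities. For each mode $x\in\{d,mC,MC\}$ let $\gamma_x(k)>0$ be the overlay SNR and $\Gamma_x(k)>0$ the underlay signal-to-interference-and-noise ratio in block $k$ (positive random variables). With $Q(y)=\frac1{\sqrt{2\pi}}\int_y^\infty e^{-t^2/2}dt$, the overlay decoding error probability after $m$ attempts is $$\zeta^x_{o,m}=Q\left(\frac{\sum_{k=1}^m\log_2(1+\gamma_x(k))+\log(ml)/l-r}{\log_2 e\,\sqrt{\sum_{k=1}^m\frac{(2+\gamma_x(k))\gamma_x(k)}{l(\gamma_x(k)+1)^2}}}\right),$$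 and $\zeta^x_{u,m}$ is the same expression with $\Gamma_x$ in place of $\gamma_x$. $\mathbb E_z$ is expectation over the fading. Set $\alpha_x=1-\mathbb E_z[\zeta^x_{u,1}]$. Matrix entries. With $\mathbf\Phi(-\theta)=\mathrm{diag}[e^{-lr\theta},1,e^{-lr\theta},1,e^{-lr\theta},1]$, $\mathbf q_1=[\alpha_d,1,\alpha_{mC},1,\alpha_{MC},1]$ and $\mathbf q_4=[\mathbb E_z[\zeta^{d}_{o,1}],1,\mathbb E_z[\zeta^{mC}_{o,1}],1,\mathbb E_z[\zeta^{MC}_{o,1}],1]$, $$b_{1,n_2}=\mathbf q_1\mathbf\Phi(-\theta)\mathbf p_u^{\top},\qquad b_{2,n_2}=\mathbf q_4\mathbf\Phi(-\theta)\mathbf p_o^{\top}.$$ *)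

theory Defs
  imports "HOL-Probability.Probability" "Jordan_Normal_Form.Spectral_Radius"
begin

datatype mode = Direct | MicroCell | MacroCell

definition gauss_Q :: "real \<Rightarrow> real" where
  "gauss_Q y = 1 / sqrt (2 * pi) * (LINT t:{y..}|lborel. exp (- (t\<^sup>2) / 2))"

text \<open>
  Finite-blocklength decoding error probability after \<open>m\<close> attempts, for a fading process
  \<open>g k \<omega>\<close> with blocks \<open>k = 1, 2, \<dots>\<close>.  The base \<open>c\<close> is that of the logarithm in the
  correction term \<open>log (m l) / l\<close>, which carries no base in the source
  (\<open>c = 2\<close> measures it in bits, \<open>c = exp 1\<close> in nats).
\<close>

definition decoding_error ::
  "real \<Rightarrow> nat \<Rightarrow> real \<Rightarrow> (nat \<Rightarrow> 'a \<Rightarrow> real) \<Rightarrow> nat \<Rightarrow> 'a \<Rightarrow> real" where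
  "decoding_error c l r g m \<omega> =
     gauss_Q (((\<Sum>k=1..m. log 2 (1 + g k \<omega>)) + log c (real m * real l) / real l - r) /
              (log 2 (exp 1) *
               sqrt (\<Sum>k=1..m. (2 + g k \<omega>) * g k \<omega> / (real l * (g k \<omega> + 1)\<^sup>2))))"

definition snr_threshold :: "real \<Rightarrow> real \<Rightarrow> real" where
  "snr_threshold r bw = 2 powr (r / bw) - 1"

text \<open>
  Probability of the link states \<open>1, \<dots>, 6\<close> in one slot, for the selected mode \<open>S\<close> and the
  link quality \<open>R x\<close> of each mode \<open>x\<close>; odd states are ON, even states are OFF.
\<close>

definition mode_of_state :: "nat \<Rightarrow> mode" where
  "mode_of_state i = (if i \<le> 2 then Direct else if i \<le> 4 then MicroCell else MacroCell)"

definition state_prob ::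
  "'a measure \<Rightarrow> real \<Rightarrow> ('a \<Rightarrow> mode) \<Rightarrow> (mode \<Rightarrow> 'a \<Rightarrow> real) \<Rightarrow> nat \<Rightarrow> real" where
  "state_prob M thr S R i =
     measure M {\<omega> \<in> space M. S \<omega> = mode_of_state i} *
     (if odd i then measure M {\<omega> \<in> space M. R (mode_of_state i) \<omega> > thr}
      else measure M {\<omega> \<in> space M. R (mode_of_state i) \<omega> \<le> thr})"

text \<open>
  The events determined by the mode selection, respectively by the fading, in one block.
  The quantities inside one such family may depend on each other arbitrarily.
\<close>

definition mode_events :: "'a measure \<Rightarrow> ('a \<Rightarrow> mode) \<Rightarrow> ('a \<Rightarrow> mode) \<Rightarrow> 'a set set" where
  "mode_events M S S' =
     sets (vimage_algebra (space M) (\<lambda>\<omega>. (S \<omega>, S' \<omega>))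
             (count_space UNIV \<Otimes>\<^sub>M count_space UNIV))"

definition fading_events ::
  "'a measure \<Rightarrow> (mode \<Rightarrow> 'a \<Rightarrow> real) \<Rightarrow> (mode \<Rightarrow> 'a \<Rightarrow> real) \<Rightarrow> (mode \<Rightarrow> 'a \<Rightarrow> real)
   \<Rightarrow> 'a set set" where
  "fading_events M g g' g'' =
     sets (vimage_algebra (space M)
             (\<lambda>\<omega>. ((\<lambda>x. g x \<omega>), (\<lambda>x. g' x \<omega>), (\<lambda>x. g'' x \<omega>)))
             (PiM UNIV (\<lambda>_. borel) \<Otimes>\<^sub>M PiM UNIV (\<lambda>_. borel) \<Otimes>\<^sub>M PiM UNIV (\<lambda>_. borel)))"

text \<open>
  Slots (fading blocks) are numbered from 1.  \<open>\<gamma>\<close> is the overlay SNR, \<open>\<Gamma>\<close> the underlay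
  SINR, \<open>sir\<close> the underlay signal-to-interference ratio, which only decides ON/OFF.
  The last two assumptions also force the state probabilities to be the same in every slot.
\<close>

locale d2d_link = prob_space M
  for M :: "'a measure" +
  fixes r bw :: real
    and sel_u sel_o :: "nat \<Rightarrow> 'a \<Rightarrow> mode"
    and \<gamma> \<Gamma> sir :: "mode \<Rightarrow> nat \<Rightarrow> 'a \<Rightarrow> real"
    and p_u p_o :: "nat \<Rightarrow> real"
  assumes bandwidth_pos: "bw > 0"
    and sel_u_rv: "k \<ge> 1 \<Longrightarrow> sel_u k \<in> measurable M (count_space UNIV)"
    and sel_o_rv: "k \<ge> 1 \<Longrightarrow> sel_o k \<in> measurable M (count_space UNIV)"
    and \<gamma>_rv: "k \<ge> 1 \<Longrightarrow> \<gamma> x k \<in> borel_measurable M"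
    and \<Gamma>_rv: "k \<ge> 1 \<Longrightarrow> \<Gamma> x k \<in> borel_measurable M"
    and sir_rv: "k \<ge> 1 \<Longrightarrow> sir x k \<in> borel_measurable M"
    and \<gamma>_pos: "k \<ge> 1 \<Longrightarrow> \<omega> \<in> space M \<Longrightarrow> \<gamma> x k \<omega> > 0"
    and \<Gamma>_pos: "k \<ge> 1 \<Longrightarrow> \<omega> \<in> space M \<Longrightarrow> \<Gamma> x k \<omega> > 0"
    and indep: "indep_sets
      (\<lambda>(k, is_mode). if is_mode then mode_events M (sel_u k) (sel_o k)
         else fading_events M (\<lambda>x. \<gamma> x k) (\<lambda>x. \<Gamma> x k) (\<lambda>x. sir x k))
      ({1..} \<times> UNIV)"
    and p_o: "k \<ge> 1 \<Longrightarrow> i \<in> {1..6} \<Longrightarrow>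
      p_o i = state_prob M (snr_threshold r bw) (sel_o k) (\<lambda>x. \<gamma> x k) i"
    and p_u: "k \<ge> 1 \<Longrightarrow> i \<in> {1..6} \<Longrightarrow>
      p_u i = state_prob M (snr_threshold r bw) (sel_u k) (\<lambda>x. sir x k) i"

definition mean_error ::
  "'a measure \<Rightarrow> real \<Rightarrow> nat \<Rightarrow> real \<Rightarrow> (nat \<Rightarrow> 'a \<Rightarrow> real) \<Rightarrow> real" where
  "mean_error M c l r g = (\<integral>\<omega>. decoding_error c l r g 1 \<omega> \<partial>M)"

definition success_prob ::
  "'a measure \<Rightarrow> real \<Rightarrow> nat \<Rightarrow> real \<Rightarrow> (nat \<Rightarrow> 'a \<Rightarrow> real) \<Rightarrow> real" where
  "success_prob M c l r g = 1 - mean_error M c l r g"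

definition Phi :: "nat \<Rightarrow> real \<Rightarrow> real \<Rightarrow> real mat" where
  "Phi l r t =
     (let e = exp (real l * r * t) in mat_diag 6 (\<lambda>i. [e, 1, e, 1, e, 1] ! i))"

definition state_vec :: "(nat \<Rightarrow> real) \<Rightarrow> real vec" where
  "state_vec p = vec_of_list [p 1, p 2, p 3, p 4, p 5, p 6]"

definition q1_vec ::
  "'a measure \<Rightarrow> real \<Rightarrow> nat \<Rightarrow> real \<Rightarrow> (mode \<Rightarrow> nat \<Rightarrow> 'a \<Rightarrow> real) \<Rightarrow> real vec" where
  "q1_vec M c l r \<Gamma> = vec_of_list
     [success_prob M c l r (\<Gamma> Direct), 1,
      success_prob M c l r (\<Gamma> MicroCell), 1,
      success_prob M c l r (\<Gamma> MacroCell), 1]"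

definition q4_vec ::
  "'a measure \<Rightarrow> real \<Rightarrow> nat \<Rightarrow> real \<Rightarrow> (mode \<Rightarrow> nat \<Rightarrow> 'a \<Rightarrow> real) \<Rightarrow> real vec" where
  "q4_vec M c l r \<gamma> = vec_of_list
     [mean_error M c l r (\<gamma> Direct), 1,
      mean_error M c l r (\<gamma> MicroCell), 1,
      mean_error M c l r (\<gamma> MacroCell), 1]"

definition b1_n2 ::
  "'a measure \<Rightarrow> real \<Rightarrow> nat \<Rightarrow> real \<Rightarrow> real \<Rightarrow>
   (mode \<Rightarrow> nat \<Rightarrow> 'a \<Rightarrow> real) \<Rightarrow> (nat \<Rightarrow> real) \<Rightarrow> real" where
  "b1_n2 M c l r \<theta> \<Gamma> p_u =
     scalar_prod (q1_vec M c l r \<Gamma>) (Phi l r (- \<theta>) *\<^sub>v state_vec p_u)"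

definition b2_n2 ::
  "'a measure \<Rightarrow> real \<Rightarrow> nat \<Rightarrow> real \<Rightarrow> real \<Rightarrow>
   (mode \<Rightarrow> nat \<Rightarrow> 'a \<Rightarrow> real) \<Rightarrow> (nat \<Rightarrow> real) \<Rightarrow> real" where
  "b2_n2 M c l r \<theta> \<gamma> p_o =
     scalar_prod (q4_vec M c l r \<gamma>) (Phi l r (- \<theta>) *\<^sub>v state_vec p_o)"

definition B_n2 ::
  "'a measure \<Rightarrow> real \<Rightarrow> nat \<Rightarrow> real \<Rightarrow> real \<Rightarrow>
   (mode \<Rightarrow> nat \<Rightarrow> 'a \<Rightarrow> real) \<Rightarrow> (mode \<Rightarrow> nat \<Rightarrow> 'a \<Rightarrow> real) \<Rightarrow>
   (nat \<Rightarrow> real) \<Rightarrow> (nat \<Rightarrow> real) \<Rightarrow> real mat" where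
  "B_n2 M c l r \<theta> \<gamma> \<Gamma> p_u p_o = mat_of_rows_list 2
     [[b1_n2 M c l r \<theta> \<Gamma> p_u, b2_n2 M c l r \<theta> \<gamma> p_o],
      [1, 0]]"

definition EC_HARQ_n2 ::
  "'a measure \<Rightarrow> real \<Rightarrow> nat \<Rightarrow> real \<Rightarrow> real \<Rightarrow>
   (mode \<Rightarrow> nat \<Rightarrow> 'a \<Rightarrow> real) \<Rightarrow> (mode \<Rightarrow> nat \<Rightarrow> 'a \<Rightarrow> real) \<Rightarrow>
   (nat \<Rightarrow> real) \<Rightarrow> (nat \<Rightarrow> real) \<Rightarrow> real" where
  "EC_HARQ_n2 M c l r \<theta> \<gamma> \<Gamma> p_u p_o =
     - (1 / \<theta>) * ln (spectral_radius (map_mat complex_of_real (B_n2 M c l r \<theta> \<gamma> \<Gamma> p_u p_o)))"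

end

theory Submission
  imports Defs
begin

text \<open>
  The two eigenvalues of \<open>[[b\<^sub>1, b\<^sub>2], [1, 0]]\<close> are the roots of \<open>z\<^sup>2 = b\<^sub>1 z + b\<^sub>2\<close>.  Since mean
  error probabilities lie in \<open>[0, 1]\<close>, both \<open>b\<^sub>1\<close> and \<open>b\<^sub>2\<close> are nonnegative; hence the roots are
  real and the one with the plus sign is the larger in modulus.
\<close>

lemma gauss_Q_nonneg: "0 \<le> gauss_Q y"
  by (simp add: gauss_Q_def set_lebesgue_integral_def)

text \<open>Q is the tail mass of the standard normal distribution, whose total mass is 1.\<close>

lemma gauss_Q_le_1: "gauss_Q y \<le> 1"
proof -
  \<comment> \<open>The normalising constant moves under the integral, where it turns the integrand
    into the normal density.\<close>
  have "gauss_Q y = (\<integral>t. indicator {y..} t * std_normal_density t \<partial>lborel)"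
    unfolding gauss_Q_def set_lebesgue_integral_def integral_mult_right_zero [symmetric]
    by (intro Bochner_Integration.integral_cong) (auto simp: std_normal_density_def)
  also have "\<dots> \<le> (\<integral>t. std_normal_density t \<partial>lborel)"
  proof (rule integral_mono)
    show "integrable lborel (\<lambda>t. indicator {y..} t * std_normal_density t)"
      using integrable_normal_density [of 1 0] integrable_real_mult_indicator [of "{y..}" lborel]
      by (simp add: mult.commute)
    show "integrable lborel std_normal_density"
      using integrable_normal_density [of 1 0] by simp
  qed (auto simp: indicator_def)
  also have "\<dots> = 1"
    using integral_normal_density [of 1 0] by simp
  finally show ?thesis .
qed

lemma mean_error_nonneg: "0 \<le> mean_error M c l r g"
  unfolding mean_error_def decoding_error_def
  by (intro integral_nonneg_AE AE_I2 gauss_Q_nonneg)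

text \<open>This bound is what makes \<open>success_prob\<close>, and with it the first entry of the
  matrix, nonnegative.\<close>

lemma mean_error_le_1:
  assumes "prob_space M"
  shows "mean_error M c l r g \<le> 1"
proof -
  interpret prob_space M by fact
  show ?thesis
  proof (cases "integrable M (decoding_error c l r g 1)")
    case True
    then show ?thesis
      unfolding mean_error_def
      by (rule integral_le_const) (simp add: decoding_error_def gauss_Q_le_1)
  next
    case False \<comment> \<open>the integral then has the junk value \<open>0\<close>\<close>
    then show ?thesis
      unfolding mean_error_def using not_integrable_integral_eq [of M "decoding_error c l r g 1"]
      by simp
  qed
qed

lemma state_prob_nonneg: "0 \<le> state_prob M thr S R i"
  by (simp add: state_prob_def)

text \<open>The vectors \<open>q1_vec\<close> and \<open>q4_vec\<close> share this shape, so one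
  computation serves both matrix entries. At the OFF states the weight and the diagonal entry of
  \<open>Phi\<close> are both 1, which leaves the bare probabilities.\<close>

lemma scalar_prod_Phi_state_vec:
  "vec_of_list [a, 1, b, 1, d, 1] \<bullet> (Phi l r (- \<theta>) *\<^sub>v state_vec p) =
     exp (- (real l * r * \<theta>)) * (p 1 * a + p 3 * b + p 5 * d) + (p 2 + p 4 + p 6)"
proof -
  have dims: "Phi l r t \<in> carrier_mat 6 6" for t
    by (simp add: Phi_def Let_def)
  have "{0..<6::nat} = {0, 1, 2, 3, 4, 5}" by auto
  then show ?thesis
    using dims [of "- \<theta>"]
    by (simp add: scalar_prod_def Phi_def Let_def mat_diag_def state_vec_def vec_of_list_index
        algebra_simps del: vec_of_list_Cons)
qed

lemma det_carrier_mat_2: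
  fixes A :: "'a :: comm_ring_1 mat"
  assumes "A \<in> carrier_mat 2 2"
  shows "det A = A $$ (0, 0) * A $$ (1, 1) - A $$ (0, 1) * A $$ (1, 0)"
proof -
  \<comment> \<open>Deleting row \<open>i\<close> and column 0 leaves a single entry, in column 1
    and the other row \<open>1 - i\<close>.\<close>
  have cofactor: "cofactor A i 0 = (-1) ^ i * A $$ (1 - i, 1)" if "i < 2" for i
    using assms that
    by (subst cofactor_def, subst det_single)
      (auto simp: mat_delete_def less_2_cases_iff)
  have "det A = (\<Sum>i<2. A $$ (i, 0) * cofactor A i 0)"
    using laplace_expansion_column [OF assms, of 0] by simp
  then show ?thesis
    by (simp add: cofactor numeral_2_eq_2 algebra_simps)
qed

text \<open>The equation on the right says that the characteristic determinant, z^2 - a z - b,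
  vanishes.\<close>

lemma eigenvalue_companion_2_iff:
  fixes a b z :: complex
  shows "eigenvalue (mat_of_rows_list 2 [[a, b], [1, 0]]) z \<longleftrightarrow> z\<^sup>2 = a * z + b"
proof -
  let ?A = "mat_of_rows_list 2 [[a, b], [1, 0]]"
  have A: "?A \<in> carrier_mat 2 2"
    by (simp add: mat_of_rows_list_def numeral_2_eq_2)
  have "char_matrix ?A z \<in> carrier_mat 2 2"
    using A by simp
  then have "det (char_matrix ?A z) = (a - z) * (0 - z) - b * 1"
    by (subst det_carrier_mat_2) (auto simp: char_matrix_def mat_of_rows_list_def)
  then show ?thesis
    unfolding eigenvalue_det [OF A] by (auto simp: algebra_simps power2_eq_square)
qed

lemma spectral_radius_companion_2:
  fixes a b :: real
  assumes "a \<ge> 0" "b \<ge> 0"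
  shows "spectral_radius (map_mat complex_of_real (mat_of_rows_list 2 [[a, b], [1, 0]])) =
    1 / 2 * (a + sqrt (a\<^sup>2 + 4 * b))"
proof -
  let ?A = "map_mat complex_of_real (mat_of_rows_list 2 [[a, b], [1, 0]])"
  define s where "s = sqrt (a\<^sup>2 + 4 * b)"
  define u v where "u = (a + s) / 2" and "v = (a - s) / 2"
  have s: "s\<^sup>2 = a\<^sup>2 + 4 * b" "s \<ge> 0"
    using assms by (auto simp: s_def)
  have vieta: "u + v = a" "u * v = - b"
    using s by (auto simp: u_def v_def field_simps power2_eq_square)
  have A: "?A = mat_of_rows_list 2 [[complex_of_real a, of_real b], [1, 0]]"
    by (rule eq_matI) (auto simp: mat_of_rows_list_def less_Suc_eq numeral_2_eq_2)
  \<comment> \<open>By Vieta's relations the real numbers \<open>u\<close> and \<open>v\<close>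
    split the characteristic polynomial over the complex numbers.\<close>
  have "z\<^sup>2 - (of_real a * z + of_real b) = (z - of_real u) * (z - of_real v)" for z :: complex
    unfolding vieta(1) [symmetric] using arg_cong [OF vieta(2), of complex_of_real]
    by (simp add: algebra_simps power2_eq_square)
  then have "z\<^sup>2 = of_real a * z + of_real b \<longleftrightarrow> z = of_real u \<or> z = of_real v" for z :: complex
    by (metis eq_iff_diff_eq_0 mult_eq_0_iff)
  then have "spectrum ?A = {of_real u, of_real v}"
    unfolding spectrum_def A eigenvalue_companion_2_iff by auto
  then have "spectral_radius ?A = max \<bar>u\<bar> \<bar>v\<bar>"
    by (simp add: spectral_radius_def)
  \<comment> \<open>As \<open>a\<close> and \<open>s\<close> are nonnegative, |a - s| is at most a +
    s.\<close>
  also have "\<dots> = u"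
    using assms s(2) by (auto simp: u_def v_def)
  finally show ?thesis by (simp add: u_def s_def)
qed

theorem mainTheorem3:
  fixes M :: "'a measure"
    and \<theta> r bw c :: real
    and l :: nat
    and sel_u sel_o :: "nat \<Rightarrow> 'a \<Rightarrow> mode"
    and \<gamma> \<Gamma> sir :: "mode \<Rightarrow> nat \<Rightarrow> 'a \<Rightarrow> real"
    and p_u p_o :: "nat \<Rightarrow> real"
  defines "\<phi> \<equiv> p_u 1 * success_prob M c l r (\<Gamma> Direct)
              + p_u 3 * success_prob M c l r (\<Gamma> MicroCell)
              + p_u 5 * success_prob M c l r (\<Gamma> MacroCell)"
    and "\<rho> \<equiv> p_o 1 * mean_error M c l r (\<gamma> Direct)
              + p_o 3 * mean_error M c l r (\<gamma> MicroCell)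
              + p_o 5 * mean_error M c l r (\<gamma> MacroCell)"
    and "p_off_u \<equiv> p_u 2 + p_u 4 + p_u 6"
    and "p_off_o \<equiv> p_o 2 + p_o 4 + p_o 6"
  assumes "\<theta> > 0" and "r > 0" and "l > 0" and "c > 1"
    and "d2d_link M r bw sel_u sel_o \<gamma> \<Gamma> sir p_u p_o"
  shows "EC_HARQ_n2 M c l r \<theta> \<gamma> \<Gamma> p_u p_o =
    - (1 / \<theta>) * ln (1 / 2 *
        ((exp (- (real l * r * \<theta>)) * \<phi> + p_off_u)
         + sqrt ((exp (- (real l * r * \<theta>)) * \<phi> + p_off_u)\<^sup>2
                 + 4 * (exp (- (real l * r * \<theta>)) * \<rho> + p_off_o))))"
proof -
  interpret d2d_link M r bw sel_u sel_o \<gamma> \<Gamma> sir p_u p_o by fact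
  \<comment> \<open>The state probabilities are the same in every slot, so slot 1 can represent them
    all.\<close>
  have p_nonneg: "0 \<le> p_u i" "0 \<le> p_o i" if "i \<in> {1..6}" for i
    using p_u [of 1 i] p_o [of 1 i] that by (simp_all add: state_prob_nonneg)
  have success_nonneg: "0 \<le> success_prob M c l r g" for g
    by (simp add: success_prob_def mean_error_le_1 prob_space_axioms)
  have b1: "b1_n2 M c l r \<theta> \<Gamma> p_u = exp (- (real l * r * \<theta>)) * \<phi> + p_off_u"
    unfolding b1_n2_def q1_vec_def scalar_prod_Phi_state_vec \<phi>_def p_off_u_def ..
  have b2: "b2_n2 M c l r \<theta> \<gamma> p_o = exp (- (real l * r * \<theta>)) * \<rho> + p_off_o"
    unfolding b2_n2_def q4_vec_def scalar_prod_Phi_state_vec \<rho>_def p_off_o_def ..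
  \<comment> \<open>This and the next fact are the sign conditions of
    \<open>spectral_radius_companion_2\<close>.\<close>
  have "0 \<le> exp (- (real l * r * \<theta>)) * \<phi> + p_off_u"
    unfolding \<phi>_def p_off_u_def
    by (intro add_nonneg_nonneg mult_nonneg_nonneg p_nonneg success_nonneg) auto
  moreover have "0 \<le> exp (- (real l * r * \<theta>)) * \<rho> + p_off_o"
    unfolding \<rho>_def p_off_o_def
    by (intro add_nonneg_nonneg mult_nonneg_nonneg p_nonneg mean_error_nonneg) auto
  ultimately show ?thesis
    unfolding EC_HARQ_n2_def B_n2_def b1 b2 by (subst spectral_radius_companion_2) auto
qed

end
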